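(* For any edge-labeled hypergraph $G=(V,E,L,\ell)$ and any $\beta\ge 0$, Algorithm 1 returns a 2-approximation for the diversity-regularized categorical edge clustering (DRCEC) objective; that is, the clustering it outputs has DRCEC objective value at most $2$ times the minimum DRCEC objective value over all clusterings. Here Algorithm 1 is: (1) compute an optimal solution $\{x_e,x_v^c\}$ of the LP relaxation of the DRCEC integer linear program; (2) for each $v\in V$, assign $v$ to any color $c\in\operatorname{argmin}_{j\in L}x_v^j$.
   Context: $G=(V,E,L,\ell)$ is a finite hypergraph with labeled hyperedges: $V$ is the node set, $E$ the set of hyperedges, $L=\{1,\dots,k\}$ the set of labels ("colors"), and $\ell\colon E\to L$ assigns a color to each hyperedge. $E_c\subseteq E$ is the set of hyperedges of color $c$. For $v\in V$, $c\in L$, the color degree $d_v^c$ is the number of hyperedges of color $c$ that contain $v$. A clustering assigns each node to exactly one color in $L$. The DRCEC objective with parameter $\beta\ge 0$ is the integer linear program $$\min\ \sum_{c\in L}\sum_{e\in E_c}x_e+\beta\sum_{v\in V}\sum_{c\in L}d_v^c(1-x_v^c)$$ subject to: $\sum_{c=1}^k x_v^c=k-1$ for all $v\in V$; $x_v^c\le x_e$ for all $c\in L$, $e\in E_c$, $v\in e$; and $x_v^c,x_e\in\{0,1\}$ for all $c\in L$, $v\in V$, $e\in E$. Here $x_v^c=0$ means that $v$ is assigned color $c$ (and $x_v^c=1$ that it is not). A clustering determines the variables $x_v^c$, and its objective value is the one obtained by setting, for $e\in E_c$, $x_e=1$ if some node of $e$ is not assigned color $c$ and $x_e=0$ otherwise.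 The LP relaxation is obtained by replacing $x_v^c,x_e\in\{0,1\}$ with $x_v^c,x_e\in[0,1]$. *)

theory Defs
  imports Complex_Main "HOL-Library.FuncSet"
begin

(* Hyperedges are abstract objects with a node set attached, so that distinct hyperedges
   (possibly of different colors) may contain the same nodes; hypergraphs whose hyperedges
   are sets of nodes are the instances with members G = id. *)
record ('v, 'e) labeled_hypergraph =
  nodes :: "'v set"
  hyperedges :: "'e set"
  members :: "'e \<Rightarrow> 'v set"
  num_colors :: nat
  color :: "'e \<Rightarrow> nat"

definition colors :: "('v, 'e) labeled_hypergraph \<Rightarrow> nat set" where
  "colors G = {1..num_colors G}"

definition wf_hypergraph :: "('v, 'e) labeled_hypergraph \<Rightarrow> bool" where
  "wf_hypergraph G \<longleftrightarrow>
     finite (nodes G) \<and> finite (hyperedges G) \<and> 1 \<le> num_colors G \<and>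
     (\<forall>e\<in>hyperedges G. members G e \<subseteq> nodes G \<and> color G e \<in> colors G)"

definition edges_of_color :: "('v, 'e) labeled_hypergraph \<Rightarrow> nat \<Rightarrow> 'e set" where
  "edges_of_color G c = {e \<in> hyperedges G. color G e = c}"

definition color_degree :: "('v, 'e) labeled_hypergraph \<Rightarrow> 'v \<Rightarrow> nat \<Rightarrow> nat" where
  "color_degree G v c = card {e \<in> edges_of_color G c. v \<in> members G e}"

definition drcec_objective ::
    "('v, 'e) labeled_hypergraph \<Rightarrow> real \<Rightarrow> ('v \<Rightarrow> nat \<Rightarrow> real) \<Rightarrow> ('e \<Rightarrow> real) \<Rightarrow> real" where
  "drcec_objective G \<beta> xv xe =
     (\<Sum>c\<in>colors G. \<Sum>e\<in>edges_of_color G c. xe e)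
     + \<beta> * (\<Sum>v\<in>nodes G. \<Sum>c\<in>colors G. real (color_degree G v c) * (1 - xv v c))"

(* D is the range of the variables: {0, 1} gives the integer program, {0..1} its LP relaxation. *)
definition drcec_feasible ::
    "real set \<Rightarrow> ('v, 'e) labeled_hypergraph \<Rightarrow> ('v \<Rightarrow> nat \<Rightarrow> real) \<Rightarrow> ('e \<Rightarrow> real) \<Rightarrow> bool" where
  "drcec_feasible D G xv xe \<longleftrightarrow>
     (\<forall>v\<in>nodes G. (\<Sum>c\<in>colors G. xv v c) = real (num_colors G) - 1) \<and>
     (\<forall>c\<in>colors G. \<forall>e\<in>edges_of_color G c. \<forall>v\<in>members G e. xv v c \<le> xe e) \<and>
     (\<forall>v\<in>nodes G. \<forall>c\<in>colors G. xv v c \<in> D) \<and>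
     (\<forall>e\<in>hyperedges G. xe e \<in> D)"

definition lp_optimal ::
    "('v, 'e) labeled_hypergraph \<Rightarrow> real \<Rightarrow> ('v \<Rightarrow> nat \<Rightarrow> real) \<Rightarrow> ('e \<Rightarrow> real) \<Rightarrow> bool" where
  "lp_optimal G \<beta> xv xe \<longleftrightarrow>
     drcec_feasible {0..1} G xv xe \<and>
     (\<forall>yv ye. drcec_feasible {0..1} G yv ye \<longrightarrow>
        drcec_objective G \<beta> xv xe \<le> drcec_objective G \<beta> yv ye)"

(* Extensional functions, so that there are only finitely many clusterings. *)
definition clusterings :: "('v, 'e) labeled_hypergraph \<Rightarrow> ('v \<Rightarrow> nat) set" where
  "clusterings G = nodes G \<rightarrow>\<^sub>E colors G"

definition node_vars :: "('v \<Rightarrow> nat) \<Rightarrow> 'v \<Rightarrow> nat \<Rightarrow> real" where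
  "node_vars \<sigma> v c = (if \<sigma> v = c then 0 else 1)"

definition edge_vars :: "('v, 'e) labeled_hypergraph \<Rightarrow> ('v \<Rightarrow> nat) \<Rightarrow> 'e \<Rightarrow> real" where
  "edge_vars G \<sigma> e = (if \<exists>v\<in>members G e. \<sigma> v \<noteq> color G e then 1 else 0)"

definition clustering_cost ::
    "('v, 'e) labeled_hypergraph \<Rightarrow> real \<Rightarrow> ('v \<Rightarrow> nat) \<Rightarrow> real" where
  "clustering_cost G \<beta> \<sigma> = drcec_objective G \<beta> (node_vars \<sigma>) (edge_vars G \<sigma>)"

(* The possible outputs of LP rounding: the optimal LP solution and the ties in the
   argmin may be chosen arbitrarily. *)
definition lp_rounding_output ::
    "('v, 'e) labeled_hypergraph \<Rightarrow> real \<Rightarrow> ('v \<Rightarrow> nat) \<Rightarrow> bool" where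
  "lp_rounding_output G \<beta> \<sigma> \<longleftrightarrow>
     \<sigma> \<in> extensional (nodes G) \<and>
     (\<exists>xv xe. lp_optimal G \<beta> xv xe \<and>
        (\<forall>v\<in>nodes G. is_arg_min (xv v) (\<lambda>j. j \<in> colors G) (\<sigma> v)))"

lemma clustering_ilp_feasible:
  assumes "wf_hypergraph G" and "\<sigma> \<in> clusterings G"
  shows "drcec_feasible {0, 1} G (node_vars \<sigma>) (edge_vars G \<sigma>)"
proof -
  have "(\<Sum>c\<in>colors G. node_vars \<sigma> v c) = real (num_colors G) - 1" if "v \<in> nodes G" for v
  proof -
    have mem: "\<sigma> v \<in> colors G" using assms(2) that by (auto simp: clusterings_def)
    have fin: "finite (colors G)" by (simp add: colors_def)
    have "(\<Sum>c\<in>colors G. node_vars \<sigma> v c) = (\<Sum>c\<in>colors G. 1 - (if \<sigma> v = c then 1 else 0))"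
      by (rule sum.cong) (auto simp: node_vars_def)
    also have "\<dots> = real (card (colors G)) - 1"
      using mem fin by (simp add: sum_subtractf)
    finally show ?thesis by (simp add: colors_def)
  qed
  then show ?thesis
    by (auto simp: drcec_feasible_def node_vars_def edge_vars_def edges_of_color_def)
qed

end

theory Submission
  imports Defs "HOL-Analysis.Function_Topology"
begin

text \<open>
  Write \<open>a\<close> for the LP mass \<open>1 - x\<^sub>v\<^sup>c\<close> of the color \<open>c\<close> chosen for the node \<open>v\<close>. Every other color has
  \<open>x\<^sub>v\<^sup>j \<ge> 1/2\<close>, so the hyperedge part of the objective at most doubles. The regularizer of a node with
  \<open>a < 1/2\<close> can grow by more than a factor 2 under rounding, so optimality of the LP solution has to
  be used: push every such node slightly away from its chosen color, by the amount \<open>\<epsilon> (1 - 2 a)\<close>. This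
  raises each hyperedge variable by at most \<open>\<epsilon> max 0 (2 x\<^sub>e - 1)\<close>, and by optimality the decrease
  of the regularizer is no larger than the sum of these. That sum is covered by what rounding the
  hyperedges leaves of the budget \<open>2 \<Sum>\<^sub>e x\<^sub>e\<close>.
\<close>

section \<open>Hyperedge sums and the existence of an optimal LP solution\<close>

lemma sum_edges_of_color:
  assumes "wf_hypergraph G"
  shows "(\<Sum>c\<in>colors G. \<Sum>e\<in>edges_of_color G c. f e) = (\<Sum>e\<in>hyperedges G. f e)"
  unfolding edges_of_color_def
  by (rule sum.group) (use assms in \<open>auto simp: wf_hypergraph_def colors_def\<close>)

lemma compact_unit_box: "compact {z :: 'i \<Rightarrow> real. \<forall>i. z i \<in> {0..1}}"
proof -
  have "compactin (product_topology (\<lambda>_. euclidean) UNIV) (PiE UNIV (\<lambda>_::'i. {0..1::real}))"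
    by (subst compactin_PiE) auto
  moreover have "PiE UNIV (\<lambda>_::'i. {0..1::real}) = {z. \<forall>i. z i \<in> {0..1}}"
    by (auto simp: PiE_def Pi_def)
  ultimately show ?thesis
    by (simp add: euclidean_product_topology)
qed

lemma ex_clustering:
  assumes "wf_hypergraph G"
  obtains \<sigma> where "\<sigma> \<in> clusterings G"
proof
  show "restrict (\<lambda>_. 1) (nodes G) \<in> clusterings G"
    using assms by (auto simp: clusterings_def wf_hypergraph_def colors_def)
qed

lemma clustering_lp_feasible:
  assumes "wf_hypergraph G" and "\<sigma> \<in> clusterings G"
  shows "drcec_feasible {0..1} G (node_vars \<sigma>) (edge_vars G \<sigma>)"
  using clustering_ilp_feasible[OF assms]
  by (auto simp: drcec_feasible_def node_vars_def edge_vars_def)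

lemma drcec_cong:
  assumes wf: "wf_hypergraph G"
    and v: "\<And>v c. v \<in> nodes G \<Longrightarrow> c \<in> colors G \<Longrightarrow> xv v c = yv v c"
    and e: "\<And>e. e \<in> hyperedges G \<Longrightarrow> xe e = ye e"
  shows "drcec_objective G \<beta> xv xe = drcec_objective G \<beta> yv ye"
    and "drcec_feasible D G xv xe = drcec_feasible D G yv ye"
proof -
  show "drcec_objective G \<beta> xv xe = drcec_objective G \<beta> yv ye"
    unfolding drcec_objective_def sum_edges_of_color[OF wf] by (simp add: v e)
  have "xv v c \<le> xe e \<longleftrightarrow> yv v c \<le> ye e"
    if "c \<in> colors G" "e \<in> edges_of_color G c" "v \<in> members G e" for v c e
  proof -
    have "e \<in> hyperedges G" "v \<in> nodes G"
      using that wf by (auto simp: edges_of_color_def wf_hypergraph_def)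
    then show ?thesis using v e that by simp
  qed
  then show "drcec_feasible D G xv xe = drcec_feasible D G yv ye"
    unfolding drcec_feasible_def by (simp add: v e cong: ball_cong)
qed

lemma ex_lp_optimal:
  assumes wf: "wf_hypergraph (G :: ('v, 'e) labeled_hypergraph)"
  obtains xv xe where "lp_optimal G \<beta> xv xe"
proof -
  \<comment> \<open>All variables are packed into one function on a sum type, so that the product
    topology applies; \<open>V\<close> and \<open>E\<close> read the two families back.\<close>
  define V where "V = (\<lambda>(z :: ('v \<times> nat) + 'e \<Rightarrow> real) v c. z (Inl (v, c)))"
  define E where "E = (\<lambda>(z :: ('v \<times> nat) + 'e \<Rightarrow> real) e. z (Inr e))"
  define B where "B = {z :: ('v \<times> nat) + 'e \<Rightarrow> real. \<forall>i. z i \<in> {0..1}}"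
  define S where "S = {z \<in> B. drcec_feasible {0..1} G (V z) (E z)}"
  define F where "F = (\<lambda>z. drcec_objective G \<beta> (V z) (E z))"
  \<comment> \<open>Inside \<open>B\<close> the range constraints hold automatically. What remains
    is an intersection of closed conditions, each on finitely many coordinates.\<close>
  have S_eq: "S = B \<inter> {z. \<forall>v. v \<in> nodes G \<longrightarrow> (\<Sum>c\<in>colors G. z (Inl (v, c))) = real (num_colors G) - 1}
      \<inter> {z. \<forall>c e v. c \<in> colors G \<and> e \<in> edges_of_color G c \<and> v \<in> members G e \<longrightarrow>
             z (Inl (v, c)) \<le> z (Inr e)}"
    by (auto simp: S_def B_def V_def E_def drcec_feasible_def)
  have "compact S"
    unfolding S_eq B_def
    by (intro compact_Int_closed compact_unit_box closed_Collect_all closed_Collect_imp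
        closed_Collect_eq closed_Collect_le open_Collect_const continuous_intros
        continuous_on_product_coordinates)
  have cont: "continuous_on S F"
    unfolding F_def drcec_objective_def V_def E_def
    by (intro continuous_intros continuous_on_product_coordinates
        continuous_on_subset[OF continuous_on_product_coordinates subset_UNIV])
  have clamp: "\<exists>z\<in>S. F z = drcec_objective G \<beta> yv ye"
    if feas: "drcec_feasible {0..1} G yv ye" for yv ye
  proof -
    \<comment> \<open>A feasible point is unconstrained off the hypergraph. Resetting those values
      to 0 brings it into the box and changes neither feasibility nor the objective.\<close>
    define z where "z = case_sum
      (\<lambda>(v, c). if v \<in> nodes G \<and> c \<in> colors G then yv v c else 0)
      (\<lambda>e. if e \<in> hyperedges G then ye e else 0)"
    have zV: "V z v c = yv v c" if "v \<in> nodes G" "c \<in> colors G" for v c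
      using that by (simp add: z_def V_def)
    have zE: "E z e = ye e" if "e \<in> hyperedges G" for e
      using that by (simp add: z_def E_def)
    have "z \<in> B"
      using feas by (auto simp: z_def B_def drcec_feasible_def split: sum.split)
    then have "z \<in> S"
      using feas drcec_cong(2)[OF wf zV zE] by (simp add: S_def)
    moreover have "F z = drcec_objective G \<beta> yv ye"
      unfolding F_def by (rule drcec_cong(1)[OF wf zV zE])
    ultimately show ?thesis by blast
  qed
  obtain \<sigma> where "\<sigma> \<in> clusterings G" using ex_clustering[OF wf] .
  then have "S \<noteq> {}" using clamp clustering_lp_feasible[OF wf] by blast
  then obtain z where z: "z \<in> S" "\<And>y. y \<in> S \<Longrightarrow> F z \<le> F y"
    using continuous_attains_inf[OF \<open>compact S\<close> _ cont] by blast
  have "lp_optimal G \<beta> (V z) (E z)"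
    unfolding lp_optimal_def
  proof (intro conjI allI impI)
    show "drcec_feasible {0..1} G (V z) (E z)" using z(1) by (simp add: S_def)
    show "drcec_objective G \<beta> (V z) (E z) \<le> drcec_objective G \<beta> yv ye"
      if "drcec_feasible {0..1} G yv ye" for yv ye
      using clamp[OF that] z(2) unfolding F_def by fastforce
  qed
  then show thesis by (rule that)
qed

section \<open>A single node: argmin bounds and the perturbation of its variables\<close>

lemma argmin_simplex_bounds:
  fixes x :: "'c \<Rightarrow> real"
  assumes fin: "finite C" and sum: "sum x C = real (card C) - 1"
    and le1: "\<And>c. c \<in> C \<Longrightarrow> x c \<le> 1"
    and min: "is_arg_min x (\<lambda>c. c \<in> C) s"
  shows "c \<in> C \<Longrightarrow> c \<noteq> s \<Longrightarrow> 1 / 2 \<le> x c"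
    and "x s \<le> 1 - 1 / real (card C)"
proof -
  have s: "s \<in> C" "\<And>c. c \<in> C \<Longrightarrow> x s \<le> x c"
    using min by (auto simp: is_arg_min_linorder)
  \<comment> \<open>The masses \<open>1 - x c\<close> form a probability distribution whose largest
    entry is at \<open>s\<close>. Two distinct colors share at most 1, so any color other than
    \<open>s\<close> has mass at most 1/2; the mass of \<open>s\<close> is at least the
    average.\<close>
  have sum1: "(\<Sum>c\<in>C. 1 - x c) = 1"
    using sum by (simp add: sum_subtractf)
  show "1 / 2 \<le> x c" if "c \<in> C" "c \<noteq> s"
  proof -
    have "(\<Sum>c\<in>{c, s}. 1 - x c) \<le> (\<Sum>c\<in>C. 1 - x c)"
      by (rule sum_mono2) (use that s(1) fin le1 in auto)
    then show ?thesis using sum1 that s(2)[of c] by simp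
  qed
  have "real (card C) * x s \<le> sum x C"
    using sum_bounded_below[of C "x s" x] s(2) by simp
  moreover have "card C > 0" using fin s(1) by (auto simp: card_gt_0_iff)
  ultimately show "x s \<le> 1 - 1 / real (card C)"
    using sum by (simp add: field_simps)
qed

text \<open>The step size is chosen to move mass \<open>\<epsilon> max 0 (1 - 2 a)\<close> away from a color of mass \<open>a\<close>:
  \<open>push_rate x * x = max 0 (2 * x - 1)\<close>, which also holds in the junk case \<open>x = 0\<close>.\<close>
definition push_rate :: "real \<Rightarrow> real" where
  "push_rate x = max 0 (2 * x - 1) / x"

text \<open>The subtracted indicator is the integral point that assigns \<open>s\<close>. The push
  follows the ray from that point through \<open>x\<close> beyond \<open>x\<close>, a difference of
  two points with equal coordinate sum when \<open>x\<close> satisfies the equality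
  constraint.\<close>

definition push :: "real \<Rightarrow> (nat \<Rightarrow> real) \<Rightarrow> nat \<Rightarrow> nat \<Rightarrow> real" where
  "push \<epsilon> x s c = x c + \<epsilon> * push_rate (x s) * (x c - (if s = c then 0 else 1))"

lemma push_rate_mult: "push_rate x * x = max 0 (2 * x - 1)"
  by (cases "x = 0") (auto simp: push_rate_def)

lemma push_rate_bounds:
  assumes "0 \<le> x" "x \<le> 1"
  shows "0 \<le> push_rate x" "push_rate x \<le> 1"
proof -
  show "0 \<le> push_rate x" using assms by (simp add: push_rate_def)
  show "push_rate x \<le> 1"
    using assms by (cases "x = 0") (auto simp: push_rate_def divide_le_eq max_def)
qed

lemma push_self: "push \<epsilon> x s s = x s + \<epsilon> * max 0 (2 * x s - 1)"
  by (simp add: push_def push_rate_mult[symmetric])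

text \<open>The mass \<open>1 - x c\<close> is multiplied by
  \<open>1 + \<epsilon> * push_rate (x s)\<close>, a factor between 1 and 2. As it was at most 1/2,
  it stays at most 1.\<close>

lemma push_other:
  assumes "c \<noteq> s" "0 \<le> \<epsilon>" "\<epsilon> \<le> 1" "0 \<le> x s" "x s \<le> 1" "1 / 2 \<le> x c" "x c \<le> 1"
  shows "0 \<le> push \<epsilon> x s c" "push \<epsilon> x s c \<le> x c"
proof -
  have eq: "push \<epsilon> x s c = x c - \<epsilon> * push_rate (x s) * (1 - x c)"
    using assms(1) by (simp add: push_def algebra_simps)
  have r: "0 \<le> \<epsilon> * push_rate (x s)" "\<epsilon> * push_rate (x s) \<le> 1"
    using assms push_rate_bounds[of "x s"] by (auto intro: mult_le_one)
  have "\<epsilon> * push_rate (x s) * (1 - x c) \<le> 1 * (1 - x c)"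
    by (rule mult_right_mono) (use assms r in auto)
  then show "0 \<le> push \<epsilon> x s c" using eq assms by simp
  have "0 \<le> \<epsilon> * push_rate (x s) * (1 - x c)"
    using r(1) assms(7) by simp
  then show "push \<epsilon> x s c \<le> x c" using eq by simp
qed

lemma sum_push:
  assumes "finite C" "s \<in> C" "sum x C = real (card C) - 1"
  shows "sum (push \<epsilon> x s) C = real (card C) - 1"
proof -
  have "(\<Sum>c\<in>C. if s = c then 0 else 1::real) = (\<Sum>c\<in>C. 1 - (if s = c then 1 else 0))"
    by (rule sum.cong) auto
  also have "\<dots> = real (card C) - 1"
    using assms by (simp add: sum_subtractf)
  finally show ?thesis
    using assms(3) by (simp add: push_def[abs_def] sum.distrib sum_subtractf flip: sum_distrib_left)
qed

text \<open>The regularizer is affine and equals \<open>d s\<close> at the integral point that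
  assigns \<open>s\<close>, so moving away from that point changes it in proportion to its
  difference from \<open>d s\<close>.\<close>

lemma regularizer_push:
  assumes "finite C" "s \<in> C"
  shows "(\<Sum>c\<in>C. d c * (1 - push \<epsilon> x s c)) =
    (\<Sum>c\<in>C. d c * (1 - x c)) - \<epsilon> * (push_rate (x s) * (d s - (\<Sum>c\<in>C. d c * (1 - x c))))"
proof -
  have "(\<Sum>c\<in>C. d c * (1 - push \<epsilon> x s c)) =
    (\<Sum>c\<in>C. d c * (1 - x c) + \<epsilon> * push_rate (x s) * (d c * (1 - x c))
       - \<epsilon> * push_rate (x s) * (if s = c then d c else 0))"
    by (rule sum.cong) (auto simp: push_def algebra_simps)
  also have "\<dots> = (\<Sum>c\<in>C. d c * (1 - x c)) + \<epsilon> * push_rate (x s) * (\<Sum>c\<in>C. d c * (1 - x c))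
       - \<epsilon> * push_rate (x s) * d s"
    using assms by (simp add: sum.distrib sum_subtractf flip: sum_distrib_left)
  finally show ?thesis by (simp add: algebra_simps)
qed

text \<open>This is where the form of \<open>push_rate\<close> pays off. For
  \<open>x s > 1/2\<close>, multiplying by \<open>x s\<close> leaves a gap between the two sides of
  exactly \<open>u - d s * (1 - x s)\<close>, and \<open>d s * (1 - x s)\<close> is one summand of
  \<open>u\<close>. For smaller \<open>x s\<close> the rate is 0 and the left side is
  nonpositive.\<close>

lemma regularizer_excess_le:
  fixes d :: "'c \<Rightarrow> real"
  assumes "finite C" "s \<in> C" and d: "\<And>c. c \<in> C \<Longrightarrow> 0 \<le> d c"
    and x: "\<And>c. c \<in> C \<Longrightarrow> x c \<le> 1"
  shows "d s - 2 * (\<Sum>c\<in>C. d c * (1 - x c)) \<le>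
    push_rate (x s) * (d s - (\<Sum>c\<in>C. d c * (1 - x c)))"
proof -
  define u where "u = (\<Sum>c\<in>C. d c * (1 - x c))"
  have u: "d s * (1 - x s) \<le> u"
    unfolding u_def by (rule member_le_sum) (use assms in auto)
  show ?thesis
  proof (cases "x s \<le> 1 / 2")
    case True
    then have "d s * (1 / 2) \<le> d s * (1 - x s)"
      using d[OF \<open>s \<in> C\<close>] by (intro mult_left_mono) auto
    then show ?thesis using True u by (simp add: push_rate_def u_def[symmetric])
  next
    case False
    then have "push_rate (x s) * (d s - u) = (2 * x s - 1) * (d s - u) / x s"
      by (simp add: push_rate_def)
    moreover have "(d s - 2 * u) * x s \<le> (2 * x s - 1) * (d s - u)"
      using u by (simp add: algebra_simps)
    ultimately show ?thesis using False by (simp add: le_divide_eq u_def[symmetric])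
  qed
qed

section \<open>Rounding an optimal LP solution at most doubles its value\<close>

lemma lp_rounding_output_clustering:
  assumes "lp_rounding_output G \<beta> \<sigma>"
  shows "\<sigma> \<in> clusterings G"
  using assms by (auto simp: lp_rounding_output_def clusterings_def PiE_def is_arg_min_def)

lemma lp_rounding_cost_le:
  assumes wf: "wf_hypergraph G" and \<beta>: "0 \<le> \<beta>" and opt: "lp_optimal G \<beta> xv xe"
    and min: "\<And>v. v \<in> nodes G \<Longrightarrow> is_arg_min (xv v) (\<lambda>j. j \<in> colors G) (\<sigma> v)"
  shows "clustering_cost G \<beta> \<sigma> \<le> 2 * drcec_objective G \<beta> xv xe"
proof -
  define k where "k = card (colors G)"
  \<comment> \<open>The variable of the chosen color is at most \<open>1 - 1 / k\<close> and the
    push raises it by at most \<open>\<epsilon>\<close>, so it stays at most 1.\<close>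
  define \<epsilon> where "\<epsilon> = 1 / real k"
  define d where "d = (\<lambda>v c. real (color_degree G v c))"
  define reg where "reg = (\<lambda>v. \<Sum>c\<in>colors G. d v c * (1 - xv v c))"
  \<comment> \<open>\<open>\<epsilon> * gain v\<close> is the (possibly negative) decrease of the
    regularizer of \<open>v\<close> under the push.\<close>
  define gain where "gain = (\<lambda>v. push_rate (xv v (\<sigma> v)) * (d v (\<sigma> v) - reg v))"
  define yv where "yv = (\<lambda>v. push \<epsilon> (xv v) (\<sigma> v))"
  define ye where "ye = (\<lambda>e. min 1 (xe e + \<epsilon> * max 0 (2 * xe e - 1)))"
  have fin: "finite (colors G)" by (simp add: colors_def)
  have k: "real k = real (num_colors G)" "1 \<le> k"
    using wf by (auto simp: k_def colors_def wf_hypergraph_def)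
  have \<epsilon>: "0 < \<epsilon>" "\<epsilon> \<le> 1" using k(2) by (auto simp: \<epsilon>_def)
  have feas: "drcec_feasible {0..1} G xv xe" using opt by (simp add: lp_optimal_def)
  have xe01: "0 \<le> xe e" "xe e \<le> 1" if "e \<in> hyperedges G" for e
    using feas that by (auto simp: drcec_feasible_def)
  have xv01: "0 \<le> xv v c" "xv v c \<le> 1" if "v \<in> nodes G" "c \<in> colors G" for v c
    using feas that by (auto simp: drcec_feasible_def)
  have xle: "xv v (color G e) \<le> xe e" if "e \<in> hyperedges G" "v \<in> members G e" for v e
    using feas wf that by (auto simp: drcec_feasible_def wf_hypergraph_def edges_of_color_def)
  have mem: "v \<in> nodes G" "color G e \<in> colors G" if "e \<in> hyperedges G" "v \<in> members G e" for v e
    using wf that by (auto simp: wf_hypergraph_def)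
  have \<sigma>: "\<sigma> v \<in> colors G" if "v \<in> nodes G" for v
    using min[OF that] by (simp add: is_arg_min_def)
  have xsum: "sum (xv v) (colors G) = real k - 1" if "v \<in> nodes G" for v
    using feas that k(1) by (auto simp: drcec_feasible_def)
  have half: "1 / 2 \<le> xv v c" if "v \<in> nodes G" "c \<in> colors G" "c \<noteq> \<sigma> v" for v c
    using argmin_simplex_bounds(1)[OF fin xsum[OF that(1), unfolded k_def] xv01(2)[OF that(1)]
        min[OF that(1)]] that by simp
  have top: "xv v (\<sigma> v) \<le> 1 - \<epsilon>" if "v \<in> nodes G" for v
    using argmin_simplex_bounds(2)[OF fin xsum[OF that, unfolded k_def] xv01(2)[OF that]
        min[OF that]] by (simp add: \<epsilon>_def k_def)
  have yv_other: "0 \<le> yv v c" "yv v c \<le> xv v c"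
    if "v \<in> nodes G" "c \<in> colors G" "c \<noteq> \<sigma> v" for v c
    unfolding yv_def
    using push_other[OF that(3), of \<epsilon> "xv v"] \<epsilon> half[OF that] xv01[OF that(1,2)]
      xv01[OF that(1) \<sigma>[OF that(1)]] by auto
  have yv_self: "yv v (\<sigma> v) = xv v (\<sigma> v) + \<epsilon> * max 0 (2 * xv v (\<sigma> v) - 1)" for v
    by (simp add: yv_def push_self)
  have yv01: "0 \<le> yv v c" "yv v c \<le> 1" if v: "v \<in> nodes G" and c: "c \<in> colors G" for v c
  proof -
    have "0 \<le> yv v c \<and> yv v c \<le> 1"
    proof (cases "c = \<sigma> v")
      case True
      have "\<epsilon> * max 0 (2 * xv v (\<sigma> v) - 1) \<le> \<epsilon> * 1"
        by (rule mult_left_mono) (use \<epsilon> xv01[OF v \<sigma>[OF v]] in auto)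
      moreover have "0 \<le> \<epsilon> * max 0 (2 * xv v (\<sigma> v) - 1)"
        using \<epsilon> by (intro mult_nonneg_nonneg) auto
      ultimately show ?thesis
        using True yv_self[of v] top[OF v] xv01[OF v \<sigma>[OF v]] by simp
    next
      case False
      then show ?thesis using yv_other[OF v c] xv01[OF v c] by simp
    qed
    then show "0 \<le> yv v c" "yv v c \<le> 1" by auto
  qed
  have "drcec_feasible {0..1} G yv ye"
    unfolding drcec_feasible_def
  proof (intro conjI ballI)
    show "(\<Sum>c\<in>colors G. yv v c) = real (num_colors G) - 1" if "v \<in> nodes G" for v
      using sum_push[OF fin \<sigma>[OF that] xsum[OF that, unfolded k_def]] k
      by (simp add: yv_def k_def)
    show "yv v c \<in> {0..1}" if "v \<in> nodes G" "c \<in> colors G" for v c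
      using yv01 that by simp
    show "ye e \<in> {0..1}" if "e \<in> hyperedges G" for e
      using xe01[OF that] \<epsilon> by (simp add: ye_def)
    show "yv v c \<le> ye e"
      if "c \<in> colors G" "e \<in> edges_of_color G c" "v \<in> members G e" for v c e
    proof -
      have e: "e \<in> hyperedges G" "color G e = c" using that by (auto simp: edges_of_color_def)
      have v: "v \<in> nodes G" using mem e that by blast
      have x: "xv v c \<le> xe e" using xle e that by blast
      have "yv v c \<le> xe e + \<epsilon> * max 0 (2 * xe e - 1)"
      proof (cases "c = \<sigma> v")
        case True
        \<comment> \<open>The raise is monotone in the variable being raised, so the constraint
          \<open>xv v c \<le> xe e\<close> carries over.\<close>
        have "\<epsilon> * max 0 (2 * xv v c - 1) \<le> \<epsilon> * max 0 (2 * xe e - 1)"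
          by (rule mult_left_mono) (use \<epsilon> x in auto)
        then show ?thesis using x yv_self[of v] True by simp
      next
        case False
        have "0 \<le> \<epsilon> * max 0 (2 * xe e - 1)" using \<epsilon> by (intro mult_nonneg_nonneg) auto
        then show ?thesis using yv_other[OF v that(1) False] x by simp
      qed
      then show ?thesis using yv01[OF v that(1)] by (simp add: ye_def)
    qed
  qed
  then have le: "drcec_objective G \<beta> xv xe \<le> drcec_objective G \<beta> yv ye"
    using opt by (simp add: lp_optimal_def)
  have objx: "drcec_objective G \<beta> xv xe = sum xe (hyperedges G) + \<beta> * sum reg (nodes G)"
    unfolding drcec_objective_def sum_edges_of_color[OF wf] by (simp add: reg_def d_def)
  have "(\<Sum>c\<in>colors G. d v c * (1 - yv v c)) = reg v - \<epsilon> * gain v" if "v \<in> nodes G" for v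
    unfolding yv_def gain_def reg_def by (rule regularizer_push[OF fin \<sigma>[OF that]])
  then have "drcec_objective G \<beta> yv ye
      = sum ye (hyperedges G) + \<beta> * (\<Sum>v\<in>nodes G. reg v - \<epsilon> * gain v)"
    unfolding drcec_objective_def sum_edges_of_color[OF wf] by (simp add: d_def)
  also have "\<dots> = sum ye (hyperedges G) + \<beta> * sum reg (nodes G) - \<epsilon> * (\<beta> * sum gain (nodes G))"
    by (simp add: sum_subtractf algebra_simps flip: sum_distrib_left)
  also have "sum ye (hyperedges G)
      \<le> (\<Sum>e\<in>hyperedges G. xe e + \<epsilon> * max 0 (2 * xe e - 1))"
    by (rule sum_mono) (simp add: ye_def)
  also have "\<dots> = sum xe (hyperedges G) + \<epsilon> * (\<Sum>e\<in>hyperedges G. max 0 (2 * xe e - 1))"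
    by (simp add: sum.distrib flip: sum_distrib_left)
  \<comment> \<open>By optimality the perturbation cannot lower the objective, so the regularizer
    saves no more than the hyperedges pay.\<close>
  finally have "\<epsilon> * (\<beta> * sum gain (nodes G)) \<le> \<epsilon> * (\<Sum>e\<in>hyperedges G. max 0 (2 * xe e - 1))"
    using le objx by simp
  then have gain_le: "\<beta> * sum gain (nodes G) \<le> (\<Sum>e\<in>hyperedges G. max 0 (2 * xe e - 1))"
    using \<epsilon> by simp
  \<comment> \<open>If rounding breaks \<open>e\<close>, some node of \<open>e\<close> has another
    chosen color, which forces \<open>xe e \<ge> 1/2\<close> and makes this an equality. Otherwise
    \<open>xe e \<ge> 0\<close> suffices.\<close>
  have "max 0 (2 * xe e - 1) \<le> 2 * xe e - edge_vars G \<sigma> e" if e: "e \<in> hyperedges G" for e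
  proof (cases "\<exists>v\<in>members G e. \<sigma> v \<noteq> color G e")
    case True
    then obtain v where v: "v \<in> members G e" "\<sigma> v \<noteq> color G e" by blast
    have "1 / 2 \<le> xe e"
      using half[OF mem[OF e v(1)]] v(2) xle[OF e v(1)] by force
    then show ?thesis using True by (simp add: edge_vars_def)
  next
    case False
    then show ?thesis using xe01[OF e] by (simp add: edge_vars_def)
  qed
  then have "(\<Sum>e\<in>hyperedges G. max 0 (2 * xe e - 1))
      \<le> (\<Sum>e\<in>hyperedges G. 2 * xe e - edge_vars G \<sigma> e)"
    by (rule sum_mono)
  also have "\<dots> = 2 * sum xe (hyperedges G) - sum (edge_vars G \<sigma>) (hyperedges G)"
    by (simp add: sum_subtractf sum_distrib_left)
  finally have edges: "sum (edge_vars G \<sigma>) (hyperedges G) + \<beta> * sum gain (nodes G)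
      \<le> 2 * sum xe (hyperedges G)"
    using gain_le by simp
  have "d v (\<sigma> v) - 2 * reg v \<le> gain v" if "v \<in> nodes G" for v
    unfolding gain_def reg_def
    by (rule regularizer_excess_le[OF fin \<sigma>[OF that]]) (use xv01 that in \<open>auto simp: d_def\<close>)
  then have "(\<Sum>v\<in>nodes G. d v (\<sigma> v) - 2 * reg v) \<le> sum gain (nodes G)"
    by (rule sum_mono)
  then have "\<beta> * (\<Sum>v\<in>nodes G. d v (\<sigma> v)) \<le> \<beta> * (sum gain (nodes G) + 2 * sum reg (nodes G))"
    using \<beta> by (intro mult_left_mono) (auto simp: sum_subtractf sum_distrib_left)
  moreover have "clustering_cost G \<beta> \<sigma>
      = sum (edge_vars G \<sigma>) (hyperedges G) + \<beta> * (\<Sum>v\<in>nodes G. d v (\<sigma> v))"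
  proof -
    have "(\<Sum>c\<in>colors G. d v c * (1 - node_vars \<sigma> v c)) = d v (\<sigma> v)" if "v \<in> nodes G" for v
    proof -
      have "(\<Sum>c\<in>colors G. d v c * (1 - node_vars \<sigma> v c))
          = (\<Sum>c\<in>colors G. if \<sigma> v = c then d v c else 0)"
        by (rule sum.cong) (auto simp: node_vars_def)
      then show ?thesis using fin \<sigma>[OF that] by simp
    qed
    then show ?thesis
      unfolding clustering_cost_def drcec_objective_def sum_edges_of_color[OF wf]
      by (simp add: d_def)
  qed
  ultimately show ?thesis
    using edges objx by (simp add: algebra_simps)
qed

theorem theorem3:
  fixes G :: "('v, 'e) labeled_hypergraph" and \<beta> :: real
  assumes "wf_hypergraph G" and "0 \<le> \<beta>"
  shows "(\<exists>\<sigma>. lp_rounding_output G \<beta> \<sigma>) \<and>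
    (\<forall>\<sigma>. lp_rounding_output G \<beta> \<sigma> \<longrightarrow>
       \<sigma> \<in> clusterings G \<and>
       clustering_cost G \<beta> \<sigma> \<le> 2 * Min (clustering_cost G \<beta> ` clusterings G))"
proof (intro conjI allI impI)
  obtain xv xe where opt: "lp_optimal G \<beta> xv xe" using ex_lp_optimal[OF assms(1)] .
  have "\<exists>c. is_arg_min (xv v) (\<lambda>j. j \<in> colors G) c" for v
    using assms(1) by (intro ex_is_arg_min_if_finite) (auto simp: colors_def wf_hypergraph_def)
  then obtain s where s: "\<And>v. is_arg_min (xv v) (\<lambda>j. j \<in> colors G) (s v)" by metis
  \<comment> \<open>The restriction makes the argmin choice extensional, as an output must
    be.\<close>
  have "lp_rounding_output G \<beta> (restrict s (nodes G))"
    unfolding lp_rounding_output_def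
    by (intro conjI exI[of _ xv] exI[of _ xe]) (auto simp: opt s)
  then show "\<exists>\<sigma>. lp_rounding_output G \<beta> \<sigma>" by blast
next
  fix \<sigma> assume out: "lp_rounding_output G \<beta> \<sigma>"
  show "\<sigma> \<in> clusterings G" using out by (rule lp_rounding_output_clustering)
  obtain xv xe where opt: "lp_optimal G \<beta> xv xe"
    and min: "\<And>v. v \<in> nodes G \<Longrightarrow> is_arg_min (xv v) (\<lambda>j. j \<in> colors G) (\<sigma> v)"
    using out by (auto simp: lp_rounding_output_def)
  have fin: "finite (clusterings G)"
    using assms(1) by (auto simp: clusterings_def wf_hypergraph_def colors_def intro: finite_PiE)
  have ne: "clusterings G \<noteq> {}" using ex_clustering[OF assms(1)] by blast
  have "Min (clustering_cost G \<beta> ` clusterings G) \<in> clustering_cost G \<beta> ` clusterings G"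
    using fin ne by (intro Min_in) auto
  then obtain \<tau> where \<tau>: "\<tau> \<in> clusterings G"
    "Min (clustering_cost G \<beta> ` clusterings G) = clustering_cost G \<beta> \<tau>" by blast
  \<comment> \<open>A best clustering is itself LP feasible, so the LP optimum bounds the minimum
    from below.\<close>
  have "drcec_objective G \<beta> xv xe \<le> clustering_cost G \<beta> \<tau>"
    using opt clustering_lp_feasible[OF assms(1) \<tau>(1)]
    by (simp add: lp_optimal_def clustering_cost_def)
  then show "clustering_cost G \<beta> \<sigma> \<le> 2 * Min (clustering_cost G \<beta> ` clusterings G)"
    using lp_rounding_cost_le[OF assms opt min] \<tau>(2) by simp
qed

end
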